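(* Let $\vartriangleright$ be an $\mathsf{S}$-consequence relation on $\mathbb{L}$. Then $\vartriangleright$ is finitary if and only if the space $\mathsf{Th}^{\mathsf{S}}(\vartriangleright)$ of all $\vartriangleright$-theory-pairs is closed under ultraproducts.
   Context: $\mathbb{L}$ is a fixed non-empty set (of sentences). An $\mathsf{S}$-consequence relation on $\mathbb{L}$ is a relation $\vartriangleright$ on $\wp(\mathbb{L})\times\wp(\mathbb{L})$ such that for all $\Pi,\Pi',\Sigma,\Sigma',\Delta\subseteq\mathbb{L}$: (i) if $\Pi\vartriangleright\Sigma$ then $\Pi'\cup\Pi\vartriangleright\Sigma\cup\Sigma'$; (ii) if $\Pi\cap\Sigma\neq\varnothing$ then $\Pi\vartriangleright\Sigma$; (iii) if $\Delta'\cup\Pi\vartriangleright\Sigma\cup(\Delta\setminus\Delta')$ for every $\Delta'\subseteq\Delta$, then $\Pi\vartriangleright\Sigma$. It is finitary if, for all $\Pi,\Sigma\subseteq\mathbb{L}$, $\Pi\vartriangleright\Sigma$ implies $\Pi'\vartriangleright\Sigma'$ for some finite $\Pi'\subseteq\Pi$ and finite $\Sigma'\subseteq\Sigma$. The operator induced by $\vartriangleright$ is $C2_{\vartriangleright}(\Pi,\Sigma):=\big(\{A\in\mathbb{L}:\Pi\vartriangleright\Sigma\cup\{A\}\},\ \{A\in\mathbb{L}:\{A\}\cup\Pi\vartriangleright\Sigma\}\big)$ for $\Pi,\Sigma\subseteq\mathbb{L}$. The space of all $\vartriangleright$-theory-pairs is $\mathsf{Th}^{\mathsf{S}}(\vartriangleright):=\{C2_{\vartriangleright}(\Gamma_1,\Gamma_0):\Gamma_0,\Gamma_1\subseteq\mathbb{L}\}$.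 An ultrafilter on a set $I$ is a set $\mathcal{U}\subseteq\wp(I)$ such that: $\varnothing\notin\mathcal{U}$; if $X\in\mathcal{U}$ and $X\subseteq Y\subseteq I$ then $Y\in\mathcal{U}$; if $X,Y\in\mathcal{U}$ then $X\cap Y\in\mathcal{U}$; for every $X\subseteq I$, $X\in\mathcal{U}$ or $I\setminus X\in\mathcal{U}$. The ultraproduct of a family $\{(\Pi_i,\Sigma_i)\}_{i\in I}\subseteq\wp(\mathbb{L})\times\wp(\mathbb{L})$ modulo an ultrafilter $\mathcal{U}$ on $I$ is the pair $(\Pi_{\mathcal{U}},\Sigma_{\mathcal{U}})$ with $\Pi_{\mathcal{U}}=\{A\in\mathbb{L}:\{i\in I:A\in\Pi_i\}\in\mathcal{U}\}$ and $\Sigma_{\mathcal{U}}=\{A\in\mathbb{L}:\{i\in I:A\in\Sigma_i\}\in\mathcal{U}\}$. A set $\mathcal{S}\subseteq\wp(\mathbb{L})\times\wp(\mathbb{L})$ is closed under ultraproducts if for every set $I$, every family of elements of $\mathcal{S}$ indexed by $I$, and every ultrafilter $\mathcal{U}$ on $I$, the ultraproduct of the family modulo $\mathcal{U}$ belongs to $\mathcal{S}$. *)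

theory Defs
  imports Main
begin

text \<open>
  The non-empty set of sentences is rendered as the type \<open>'a\<close>: every HOL type is non-empty, and
  \<open>'a\<close> is otherwise arbitrary.
\<close>

definition S_consequence :: "('a set \<Rightarrow> 'a set \<Rightarrow> bool) \<Rightarrow> bool" where
  "S_consequence R \<longleftrightarrow>
     (\<forall>\<Pi> \<Pi>' \<Sigma> \<Sigma>'. R \<Pi> \<Sigma> \<longrightarrow> R (\<Pi>' \<union> \<Pi>) (\<Sigma> \<union> \<Sigma>')) \<and>
     (\<forall>\<Pi> \<Sigma>. \<Pi> \<inter> \<Sigma> \<noteq> {} \<longrightarrow> R \<Pi> \<Sigma>) \<and>
     (\<forall>\<Pi> \<Sigma> \<Delta>. (\<forall>\<Delta>'\<subseteq>\<Delta>. R (\<Delta>' \<union> \<Pi>) (\<Sigma> \<union> (\<Delta> - \<Delta>'))) \<longrightarrow> R \<Pi> \<Sigma>)"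

definition finitary :: "('a set \<Rightarrow> 'a set \<Rightarrow> bool) \<Rightarrow> bool" where
  "finitary R \<longleftrightarrow>
     (\<forall>\<Pi> \<Sigma>. R \<Pi> \<Sigma> \<longrightarrow>
        (\<exists>\<Pi>' \<Sigma>'. finite \<Pi>' \<and> \<Pi>' \<subseteq> \<Pi> \<and> finite \<Sigma>' \<and> \<Sigma>' \<subseteq> \<Sigma> \<and> R \<Pi>' \<Sigma>'))"

definition C2 :: "('a set \<Rightarrow> 'a set \<Rightarrow> bool) \<Rightarrow> 'a set \<Rightarrow> 'a set \<Rightarrow> 'a set \<times> 'a set" where
  "C2 R \<Pi> \<Sigma> = ({A. R \<Pi> (\<Sigma> \<union> {A})}, {A. R ({A} \<union> \<Pi>) \<Sigma>})"

definition theory_pairs :: "('a set \<Rightarrow> 'a set \<Rightarrow> bool) \<Rightarrow> ('a set \<times> 'a set) set" where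
  "theory_pairs R = {C2 R \<Gamma>1 \<Gamma>0 | \<Gamma>1 \<Gamma>0. True}"

definition ultrafilter_on :: "'i set \<Rightarrow> 'i set set \<Rightarrow> bool" where
  "ultrafilter_on I U \<longleftrightarrow>
     U \<subseteq> Pow I \<and>
     {} \<notin> U \<and>
     (\<forall>X Y. X \<in> U \<and> X \<subseteq> Y \<and> Y \<subseteq> I \<longrightarrow> Y \<in> U) \<and>
     (\<forall>X Y. X \<in> U \<and> Y \<in> U \<longrightarrow> X \<inter> Y \<in> U) \<and>
     (\<forall>X\<subseteq>I. X \<in> U \<or> I - X \<in> U)"

definition ultraproduct ::
  "'i set \<Rightarrow> 'i set set \<Rightarrow> ('i \<Rightarrow> 'a set \<times> 'a set) \<Rightarrow> 'a set \<times> 'a set" where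
  "ultraproduct I U F = ({A. {i \<in> I. A \<in> fst (F i)} \<in> U}, {A. {i \<in> I. A \<in> snd (F i)} \<in> U})"

text \<open>
  A HOL formula cannot quantify over all sets \<open>I\<close> of all types, so the type of the indices is a
  parameter. Index sets drawn from \<open>'a set \<times> 'a set\<close> already give closure for index sets of every
  type, because an ultrafilter on \<open>I\<close> can be pushed forward along the family; this is the lemma
  \<open>closed_under_ultraproducts_any_index\<close> below.
\<close>

definition closed_under_ultraproducts :: "'i itself \<Rightarrow> ('a set \<times> 'a set) set \<Rightarrow> bool" where
  "closed_under_ultraproducts _ S \<longleftrightarrow>
     (\<forall>(I :: 'i set) F U. (\<forall>i\<in>I. F i \<in> S) \<and> ultrafilter_on I U \<longrightarrow> ultraproduct I U F \<in> S)"

lemma closed_under_ultraproducts_any_index: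
  fixes S :: "('a set \<times> 'a set) set"
  assumes "closed_under_ultraproducts TYPE('a set \<times> 'a set) S"
  shows "closed_under_ultraproducts TYPE('i) S"
  unfolding closed_under_ultraproducts_def
proof (intro allI impI, elim conjE)
  fix I :: "'i set" and F U
  assume F: "\<forall>i\<in>I. F i \<in> S" and U: "ultrafilter_on I U"
  define V where "V = {X. X \<subseteq> S \<and> {i \<in> I. F i \<in> X} \<in> U}"
  have up: "\<And>X Y. X \<in> U \<Longrightarrow> X \<subseteq> Y \<Longrightarrow> Y \<subseteq> I \<Longrightarrow> Y \<in> U"
    and int: "\<And>X Y. X \<in> U \<Longrightarrow> Y \<in> U \<Longrightarrow> X \<inter> Y \<in> U"
    and max: "\<And>X. X \<subseteq> I \<Longrightarrow> X \<in> U \<or> I - X \<in> U"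
    and nonempty: "{} \<notin> U"
    using U unfolding ultrafilter_on_def by blast+
  have "ultrafilter_on S V"
    unfolding ultrafilter_on_def
  proof (intro conjI allI impI)
    show "V \<subseteq> Pow S" "{} \<notin> V"
      using nonempty by (auto simp: V_def)
  next
    fix X Y assume "X \<in> V \<and> X \<subseteq> Y \<and> Y \<subseteq> S"
    then show "Y \<in> V"
      using up[of "{i \<in> I. F i \<in> X}" "{i \<in> I. F i \<in> Y}"] by (auto simp: V_def)
  next
    fix X Y assume "X \<in> V \<and> Y \<in> V"
    moreover have "{i \<in> I. F i \<in> X \<inter> Y} = {i \<in> I. F i \<in> X} \<inter> {i \<in> I. F i \<in> Y}"
      by blast
    ultimately show "X \<inter> Y \<in> V"
      using int by (auto simp: V_def)
  next
    fix X assume "X \<subseteq> S"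
    moreover have "{i \<in> I. F i \<in> S - X} = I - {i \<in> I. F i \<in> X}"
      using F by blast
    ultimately show "X \<in> V \<or> S - X \<in> V"
      using max[of "{i \<in> I. F i \<in> X}"] by (auto simp: V_def)
  qed
  then have "ultraproduct S V (\<lambda>p. p) \<in> S"
    using assms unfolding closed_under_ultraproducts_def by simp
  moreover have "{i \<in> I. F i \<in> S \<and> A \<in> fst (F i)} = {i \<in> I. A \<in> fst (F i)}"
    "{i \<in> I. F i \<in> S \<and> A \<in> snd (F i)} = {i \<in> I. A \<in> snd (F i)}" for A
    using F by blast+
  then have "ultraproduct S V (\<lambda>p. p) = ultraproduct I U F"
    by (simp add: ultraproduct_def V_def)
  ultimately show "ultraproduct I U F \<in> S"
    by simp
qed

end

theory Submission
  imports Defs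
begin

text \<open>
  Cut makes every theory-pair closed under the relation. A finitary relation derives a sentence
  from an ultraproduct using only finitely many sentences of it, and these belong to almost all
  factors, so the ultraproduct is closed too. Conversely, let \<open>\<Pi>\<close> be related to \<open>\<Sigma>\<close> with no finite
  subpair related. Index by the finite subpairs of \<open>(\<Pi>, \<Sigma>)\<close>, with an ultrafilter containing the
  upward cones. The ultraproduct of the theory-pairs they generate contains \<open>(\<Pi>, \<Sigma>)\<close>, so if it is
  a theory-pair it is the trivial one; then any sentence lies in both components of some
  factor, and cutting it relates the corresponding finite subpair.
\<close>

section \<open>Ultrafilters and their existence\<close>

lemma ultrafilter_onD:
  assumes "ultrafilter_on I U"
  shows "{} \<notin> U"
    "X \<in> U \<Longrightarrow> X \<subseteq> Y \<Longrightarrow> Y \<subseteq> I \<Longrightarrow> Y \<in> U"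
    "X \<in> U \<Longrightarrow> Y \<in> U \<Longrightarrow> X \<inter> Y \<in> U"
    "I \<in> U"
proof -
  have empty: "{} \<notin> U"
    and up: "\<forall>X Y. X \<in> U \<and> X \<subseteq> Y \<and> Y \<subseteq> I \<longrightarrow> Y \<in> U"
    and Int: "\<forall>X Y. X \<in> U \<and> Y \<in> U \<longrightarrow> X \<inter> Y \<in> U"
    and compl: "\<forall>X\<subseteq>I. X \<in> U \<or> I - X \<in> U"
    using assms unfolding ultrafilter_on_def by - (elim conjE, assumption)+
  show "{} \<notin> U"
    by (rule empty)
  show "Y \<in> U" if "X \<in> U" "X \<subseteq> Y" "Y \<subseteq> I"
    using up that by simp
  show "X \<inter> Y \<in> U" if "X \<in> U" "Y \<in> U"
    using Int that by simp
  show "I \<in> U"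
    using compl[rule_format, of I] empty by simp
qed

lemma ultrafilter_on_finite_Ball:
  assumes U: "ultrafilter_on I U" and "finite P" and "\<And>A. A \<in> P \<Longrightarrow> {i \<in> I. Q i A} \<in> U"
  shows "{i \<in> I. \<forall>A\<in>P. Q i A} \<in> U"
  using assms(2,3)
proof (induction P)
  case empty
  then show ?case
    using ultrafilter_onD(4)[OF U] by simp
next
  case (insert A P)
  have "{i \<in> I. \<forall>B\<in>insert A P. Q i B} = {i \<in> I. Q i A} \<inter> {i \<in> I. \<forall>B\<in>P. Q i B}"
    by blast
  then show ?case
    using insert ultrafilter_onD(3)[OF U] by simp
qed

text \<open>By Zorn, \<open>B\<close> lies in a maximal family of subsets of \<open>I\<close> with
  the finite intersection property, and maximality makes that family an ultrafilter. The factor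
  \<open>I\<close> in the condition matters at \<open>W = {}\<close>, where it says that
  \<open>I\<close> is non-empty.\<close>

lemma ultrafilter_on_extends_fip:
  assumes "B \<subseteq> Pow I" and "\<And>W. finite W \<Longrightarrow> W \<subseteq> B \<Longrightarrow> I \<inter> \<Inter>W \<noteq> {}"
  shows "\<exists>U. ultrafilter_on I U \<and> B \<subseteq> U"
proof -
  define fip where "fip U \<longleftrightarrow> (\<forall>W. finite W \<and> W \<subseteq> U \<longrightarrow> I \<inter> \<Inter>W \<noteq> {})" for U
  define Fam where "Fam = {U. B \<subseteq> U \<and> U \<subseteq> Pow I \<and> fip U}"
  have "B \<in> Fam"
    using assms by (simp add: Fam_def fip_def)
  then have "Fam \<noteq> {}"
    by blast
  moreover have "\<Union>C \<in> Fam" if chain: "C \<noteq> {}" "subset.chain Fam C" for C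
  proof -
    have C: "C \<subseteq> Fam"
      using chain by (simp add: subset.chain_def)
    have "fip (\<Union>C)"
      unfolding fip_def
    proof (intro allI impI, elim conjE)
      fix W assume "finite W" "W \<subseteq> \<Union>C"
      then obtain U where "U \<in> C" "W \<subseteq> U"
        by (rule finite_subset_Union_chain[OF _ _ chain])
      then have "fip U"
        using C by (auto simp: Fam_def)
      then show "I \<inter> \<Inter>W \<noteq> {}"
        using \<open>finite W\<close> \<open>W \<subseteq> U\<close> by (simp add: fip_def)
    qed
    moreover have "B \<subseteq> V" "V \<subseteq> Pow I" if "V \<in> C" for V
      using C that by (auto simp: Fam_def)
    then have "B \<subseteq> \<Union>C" "\<Union>C \<subseteq> Pow I"
      using \<open>C \<noteq> {}\<close> by blast+
    ultimately show ?thesis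
      by (simp add: Fam_def)
  qed
  ultimately have "\<exists>U\<in>Fam. \<forall>V\<in>Fam. U \<subseteq> V \<longrightarrow> V = U"
    by (rule subset_Zorn_nonempty)
  then obtain U where "U \<in> Fam" and max: "\<And>V. V \<in> Fam \<Longrightarrow> U \<subseteq> V \<Longrightarrow> V = U"
    by blast
  from \<open>U \<in> Fam\<close> have U: "B \<subseteq> U" "U \<subseteq> Pow I" "\<And>W. finite W \<Longrightarrow> W \<subseteq> U \<Longrightarrow> I \<inter> \<Inter>W \<noteq> {}"
    by (simp_all add: Fam_def fip_def)
  \<comment> \<open>A subset of \<open>I\<close> that meets every finite intersection from
    \<open>U\<close> can be added without losing the property, so by maximality it is already in
    \<open>U\<close>. The remaining closure conditions all reduce to this criterion.\<close>
  have mem: "X \<in> U" if X: "X \<subseteq> I" and meets: "\<And>W. finite W \<Longrightarrow> W \<subseteq> U \<Longrightarrow> X \<inter> \<Inter>W \<noteq> {}" for X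
  proof -
    have "I \<inter> \<Inter>W \<noteq> {}" if "finite W" "W \<subseteq> insert X U" for W
    proof -
      have "X \<inter> \<Inter>(W - {X}) \<noteq> {}"
        using that by (intro meets) auto
      then show ?thesis
        using X by blast
    qed
    then have "insert X U \<in> Fam"
      using U(1,2) X by (auto simp: Fam_def fip_def)
    then show ?thesis
      using max[of "insert X U"] by auto
  qed
  have "ultrafilter_on I U"
    unfolding ultrafilter_on_def
  proof (intro conjI allI impI)
    show "U \<subseteq> Pow I"
      by (rule U)
    show "{} \<notin> U"
      using U(3)[of "{{}}"] by auto
  next
    fix X Y assume "X \<in> U \<and> X \<subseteq> Y \<and> Y \<subseteq> I"
    moreover from this have "Y \<inter> \<Inter>W \<noteq> {}" if "finite W" "W \<subseteq> U" for W
      using U(3)[of "insert X W"] that by auto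
    ultimately show "Y \<in> U"
      using mem by blast
  next
    fix X Y assume XY: "X \<in> U \<and> Y \<in> U"
    then have "X \<inter> Y \<inter> \<Inter>W \<noteq> {}" if "finite W" "W \<subseteq> U" for W
      using U(3)[of "insert X (insert Y W)"] that by auto
    moreover have "X \<inter> Y \<subseteq> I"
      using XY U(2) by blast
    ultimately show "X \<inter> Y \<in> U"
      using mem by blast
  next
    fix X assume "X \<subseteq> I"
    show "X \<in> U \<or> I - X \<in> U"
    proof (rule disjCI)
      assume "I - X \<notin> U"
      then obtain W where W: "finite W" "W \<subseteq> U" "(I - X) \<inter> \<Inter>W = {}"
        using mem[of "I - X"] by blast
      have "X \<inter> \<Inter>W' \<noteq> {}" if "finite W'" "W' \<subseteq> U" for W'
      proof -
        \<comment> \<open>A point of \<open>I\<close> in all members of \<open>W\<close> and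
          \<open>W'\<close> lies outside \<open>I - X\<close> by the choice of \<open>W\<close>,
          hence in \<open>X\<close>.\<close>
        have "I \<inter> \<Inter>(W \<union> W') \<noteq> {}"
          using W that by (intro U(3)) auto
        then show ?thesis
          using W(3) by blast
      qed
      then show "X \<in> U"
        using mem \<open>X \<subseteq> I\<close> by blast
    qed
  qed
  then show ?thesis
    using U(1) by blast
qed

section \<open>Weakening, overlap and cut\<close>

lemma S_consequence_weaken:
  assumes "S_consequence R" "R \<Pi> \<Sigma>" "\<Pi> \<subseteq> \<Pi>'" "\<Sigma> \<subseteq> \<Sigma>'"
  shows "R \<Pi>' \<Sigma>'"
proof -
  have "\<forall>\<Pi> \<Pi>' \<Sigma> \<Sigma>'. R \<Pi> \<Sigma> \<longrightarrow> R (\<Pi>' \<union> \<Pi>) (\<Sigma> \<union> \<Sigma>')"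
    using assms(1) unfolding S_consequence_def by (rule conjunct1)
  then have "R (\<Pi>' \<union> \<Pi>) (\<Sigma> \<union> \<Sigma>')"
    using assms(2) by simp
  then show ?thesis
    using assms(3,4) by (simp add: Un_absorb1 Un_absorb2)
qed

lemma S_consequence_overlap:
  assumes "S_consequence R" "A \<in> \<Pi>" "A \<in> \<Sigma>"
  shows "R \<Pi> \<Sigma>"
proof -
  have "\<Pi> \<inter> \<Sigma> \<noteq> {}"
    using assms(2,3) by blast
  then show ?thesis
    using assms(1) unfolding S_consequence_def by simp
qed

text \<open>Clause (iii) is applied with \<open>P \<union> S\<close> as the set to be cut. Each
  choice of \<open>D\<close> leaves some member of \<open>P\<close> on the right, or puts some
  member of \<open>S\<close> on the left, or sends \<open>P\<close> left and \<open>S\<close> right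
  as in \<open>PS\<close>.\<close>

lemma S_consequence_cut:
  assumes R: "S_consequence R"
    and PS: "R (\<Pi> \<union> P) (\<Sigma> \<union> S)"
    and P: "\<And>B. B \<in> P \<Longrightarrow> R \<Pi> (\<Sigma> \<union> {B})"
    and S: "\<And>B. B \<in> S \<Longrightarrow> R ({B} \<union> \<Pi>) \<Sigma>"
  shows "R \<Pi> \<Sigma>"
proof -
  have "R (D \<union> \<Pi>) (\<Sigma> \<union> (P \<union> S - D))" for D
  proof -
    consider B where "B \<in> P" "B \<notin> D" | B where "B \<in> S" "B \<in> D" | "P \<subseteq> D" "S \<inter> D = {}"
      by blast
    then show ?thesis
    proof cases
      case 1
      show ?thesis
        by (rule S_consequence_weaken[OF R P[OF 1(1)]]) (use 1 in auto)
    next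
      case 2
      show ?thesis
        by (rule S_consequence_weaken[OF R S[OF 2(1)]]) (use 2 in auto)
    next
      case 3
      show ?thesis
        by (rule S_consequence_weaken[OF R PS]) (use 3 in auto)
    qed
  qed
  then have "\<forall>D\<subseteq>P \<union> S. R (D \<union> \<Pi>) (\<Sigma> \<union> (P \<union> S - D))"
    by simp
  then show ?thesis
    using R unfolding S_consequence_def by meson
qed

lemma S_consequence_cut_formula:
  assumes "S_consequence R" "R \<Pi> (\<Sigma> \<union> {A})" "R ({A} \<union> \<Pi>) \<Sigma>"
  shows "R \<Pi> \<Sigma>"
  by (rule S_consequence_cut[OF assms(1), of \<Pi> "{A}" \<Sigma> "{}"]) (use assms in \<open>auto simp: Un_commute\<close>)

section \<open>Theory-pairs as fixed points of \<open>C2\<close>\<close>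

lemma C2_extensive:
  assumes "S_consequence R"
  shows "\<Pi> \<subseteq> fst (C2 R \<Pi> \<Sigma>)" "\<Sigma> \<subseteq> snd (C2 R \<Pi> \<Sigma>)"
  by (auto simp: C2_def intro: S_consequence_overlap[OF assms])

text \<open>Cut removes at once all sentences that \<open>C2\<close> adds. The contexts
  \<open>\<Pi>\<close> and \<open>\<Sigma>\<close> leave room for the one sentence whose membership
  in a theory-pair is tested later.\<close>

lemma S_consequence_C2_elim:
  assumes R: "S_consequence R"
    and "R (fst (C2 R \<Gamma>1 \<Gamma>0) \<union> \<Pi>) (snd (C2 R \<Gamma>1 \<Gamma>0) \<union> \<Sigma>)"
  shows "R (\<Gamma>1 \<union> \<Pi>) (\<Gamma>0 \<union> \<Sigma>)"
proof (rule S_consequence_cut[OF R])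
  show "R (\<Gamma>1 \<union> \<Pi> \<union> fst (C2 R \<Gamma>1 \<Gamma>0)) (\<Gamma>0 \<union> \<Sigma> \<union> snd (C2 R \<Gamma>1 \<Gamma>0))"
    by (rule S_consequence_weaken[OF assms]) auto
next
  fix B assume "B \<in> fst (C2 R \<Gamma>1 \<Gamma>0)"
  then have "R \<Gamma>1 (\<Gamma>0 \<union> {B})"
    by (simp add: C2_def)
  then show "R (\<Gamma>1 \<union> \<Pi>) (\<Gamma>0 \<union> \<Sigma> \<union> {B})"
    by (rule S_consequence_weaken[OF R]) auto
next
  fix B assume "B \<in> snd (C2 R \<Gamma>1 \<Gamma>0)"
  then have "R ({B} \<union> \<Gamma>1) \<Gamma>0"
    by (simp add: C2_def)
  then show "R ({B} \<union> (\<Gamma>1 \<union> \<Pi>)) (\<Gamma>0 \<union> \<Sigma>)"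
    by (rule S_consequence_weaken[OF R]) auto
qed

lemma theory_pairs_closed:
  assumes R: "S_consequence R" and "p \<in> theory_pairs R"
  shows "R (fst p) (snd p \<union> {A}) \<Longrightarrow> A \<in> fst p"
    and "R ({A} \<union> fst p) (snd p) \<Longrightarrow> A \<in> snd p"
proof -
  obtain \<Gamma>1 \<Gamma>0 where p: "p = C2 R \<Gamma>1 \<Gamma>0"
    using assms(2) by (auto simp: theory_pairs_def)
  show "A \<in> fst p" if "R (fst p) (snd p \<union> {A})"
    using S_consequence_C2_elim[OF R, of \<Gamma>1 \<Gamma>0 "{}" "{A}"] that by (simp add: p C2_def)
  show "A \<in> snd p" if "R ({A} \<union> fst p) (snd p)"
    using S_consequence_C2_elim[OF R, of \<Gamma>1 \<Gamma>0 "{A}" "{}"] that by (simp add: p C2_def)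
qed

text \<open>Extensivity gives the inclusions opposite to the assumed ones, so \<open>p\<close> is
  fixed by \<open>C2\<close> and serves as its own generator.\<close>

lemma theory_pairs_closedI:
  assumes R: "S_consequence R"
    and "\<And>A. R (fst p) (snd p \<union> {A}) \<Longrightarrow> A \<in> fst p"
    and "\<And>A. R ({A} \<union> fst p) (snd p) \<Longrightarrow> A \<in> snd p"
  shows "p \<in> theory_pairs R"
proof -
  have "fst (C2 R (fst p) (snd p)) = fst p" "snd (C2 R (fst p) (snd p)) = snd p"
    using assms(2,3) C2_extensive(1)[OF R, of "fst p" "snd p"]
      C2_extensive(2)[OF R, of "snd p" "fst p"] by (auto simp: C2_def)
  then have "p = C2 R (fst p) (snd p)"
    by (simp add: prod_eq_iff)
  then show ?thesis
    unfolding theory_pairs_def by blast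
qed

section \<open>From finitarity to closure under ultraproducts\<close>

lemma finitary_split:
  assumes R: "S_consequence R" and "finitary R" and "R (\<Pi> \<union> X) (\<Sigma> \<union> Y)"
  shows "\<exists>\<Pi>' \<Sigma>'. finite \<Pi>' \<and> \<Pi>' \<subseteq> \<Pi> \<and> finite \<Sigma>' \<and> \<Sigma>' \<subseteq> \<Sigma> \<and> R (\<Pi>' \<union> X) (\<Sigma>' \<union> Y)"
proof -
  obtain \<Pi>' \<Sigma>' where fin: "finite \<Pi>'" "\<Pi>' \<subseteq> \<Pi> \<union> X" "finite \<Sigma>'" "\<Sigma>' \<subseteq> \<Sigma> \<union> Y" and "R \<Pi>' \<Sigma>'"
    using assms(2,3) unfolding finitary_def by metis
  \<comment> \<open>Members of the finite witness outside \<open>\<Pi>\<close> or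
    \<open>\<Sigma>\<close> lie in \<open>X\<close> or \<open>Y\<close>, which are restored
    whole.\<close>
  have "R (\<Pi>' \<inter> \<Pi> \<union> X) (\<Sigma>' \<inter> \<Sigma> \<union> Y)"
    by (rule S_consequence_weaken[OF R \<open>R \<Pi>' \<Sigma>'\<close>]) (use fin in auto)
  then show ?thesis
    using fin by (intro exI[of _ "\<Pi>' \<inter> \<Pi>"] exI[of _ "\<Sigma>' \<inter> \<Sigma>"]) auto
qed

text \<open>Each of the finitely many memberships holds on a set in \<open>U\<close>, so all hold
  together on the intersection of these sets.\<close>

lemma ultraproduct_finite_subpair:
  assumes U: "ultrafilter_on I U"
    and "finite P" "P \<subseteq> fst (ultraproduct I U F)" "finite S" "S \<subseteq> snd (ultraproduct I U F)"
  shows "{i \<in> I. P \<subseteq> fst (F i) \<and> S \<subseteq> snd (F i)} \<in> U"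
proof -
  have "{i \<in> I. \<forall>A\<in>P. A \<in> fst (F i)} \<in> U" "{i \<in> I. \<forall>A\<in>S. A \<in> snd (F i)} \<in> U"
    using assms by (auto intro!: ultrafilter_on_finite_Ball[OF U] simp: ultraproduct_def)
  moreover have "{i \<in> I. P \<subseteq> fst (F i) \<and> S \<subseteq> snd (F i)} =
      {i \<in> I. \<forall>A\<in>P. A \<in> fst (F i)} \<inter> {i \<in> I. \<forall>A\<in>S. A \<in> snd (F i)}"
    by blast
  ultimately show ?thesis
    using ultrafilter_onD(3)[OF U] by simp
qed

lemma finitary_imp_closed_under_ultraproducts:
  fixes R :: "'a set \<Rightarrow> 'a set \<Rightarrow> bool"
  assumes R: "S_consequence R" and fin: "finitary R"
  shows "closed_under_ultraproducts TYPE('i) (theory_pairs R)"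
  unfolding closed_under_ultraproducts_def
proof (intro allI impI, elim conjE)
  fix I :: "'i set" and F U
  assume F: "\<forall>i\<in>I. F i \<in> theory_pairs R" and U: "ultrafilter_on I U"
  define p where "p = ultraproduct I U F"
  have p_fst: "A \<in> fst p \<longleftrightarrow> {i \<in> I. A \<in> fst (F i)} \<in> U"
    and p_snd: "A \<in> snd p \<longleftrightarrow> {i \<in> I. A \<in> snd (F i)} \<in> U" for A
    by (simp_all add: p_def ultraproduct_def)
  have "p \<in> theory_pairs R"
  proof (rule theory_pairs_closedI[OF R])
    fix A assume "R (fst p) (snd p \<union> {A})"
    then obtain P S where PS: "finite P" "P \<subseteq> fst p" "finite S" "S \<subseteq> snd p" and "R P (S \<union> {A})"
      using finitary_split[OF R fin, of "fst p" "{}" "snd p" "{A}"] by auto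
    \<comment> \<open>A factor containing \<open>P\<close> and \<open>S\<close> inherits the
      derivation of \<open>A\<close> by weakening, and theory-pairs are closed; the indices of such
      factors form a set in \<open>U\<close>.\<close>
    have "A \<in> fst (F i)" if "i \<in> I" "P \<subseteq> fst (F i)" "S \<subseteq> snd (F i)" for i
    proof (rule theory_pairs_closed(1)[OF R])
      show "R (fst (F i)) (snd (F i) \<union> {A})"
        by (rule S_consequence_weaken[OF R \<open>R P (S \<union> {A})\<close>]) (use that in auto)
    qed (use F that in blast)
    then have "{i \<in> I. P \<subseteq> fst (F i) \<and> S \<subseteq> snd (F i)} \<subseteq> {i \<in> I. A \<in> fst (F i)}"
      by blast
    then show "A \<in> fst p"
      unfolding p_fst
      using ultrafilter_onD(2)[OF U ultraproduct_finite_subpair[OF U PS[unfolded p_def]]] by blast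
  next
    fix A assume "R ({A} \<union> fst p) (snd p)"
    then obtain P S where PS: "finite P" "P \<subseteq> fst p" "finite S" "S \<subseteq> snd p" and "R (P \<union> {A}) S"
      using finitary_split[OF R fin, of "fst p" "{A}" "snd p" "{}"] by (auto simp: Un_commute)
    have "A \<in> snd (F i)" if "i \<in> I" "P \<subseteq> fst (F i)" "S \<subseteq> snd (F i)" for i
    proof (rule theory_pairs_closed(2)[OF R])
      show "R ({A} \<union> fst (F i)) (snd (F i))"
        by (rule S_consequence_weaken[OF R \<open>R (P \<union> {A}) S\<close>]) (use that in auto)
    qed (use F that in blast)
    then have "{i \<in> I. P \<subseteq> fst (F i) \<and> S \<subseteq> snd (F i)} \<subseteq> {i \<in> I. A \<in> snd (F i)}"
      by blast
    then show "A \<in> snd p"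
      unfolding p_snd
      using ultrafilter_onD(2)[OF U ultraproduct_finite_subpair[OF U PS[unfolded p_def]]] by blast
  qed
  then show "ultraproduct I U F \<in> theory_pairs R"
    by (simp add: p_def)
qed

section \<open>From closure under ultraproducts to finitarity\<close>

lemma closed_under_ultraproducts_imp_finitary:
  fixes R :: "'a set \<Rightarrow> 'a set \<Rightarrow> bool"
  assumes R: "S_consequence R"
    and closed: "closed_under_ultraproducts TYPE('a set \<times> 'a set) (theory_pairs R)"
  shows "finitary R"
  unfolding finitary_def
proof (intro allI impI)
  fix \<Pi> \<Sigma> assume "R \<Pi> \<Sigma>"
  \<comment> \<open>Finite subpairs are themselves pairs of sets of sentences, so they fit the index
    type in \<open>closed\<close>. With the cones in the ultrafilter, any given sentence of
    \<open>\<Pi>\<close> or \<open>\<Sigma>\<close> belongs to almost every index on its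
    side.\<close>
  define I where "I = {(P, S). finite P \<and> P \<subseteq> \<Pi> \<and> finite S \<and> S \<subseteq> \<Sigma>}"
  define cone where "cone i = {j \<in> I. fst i \<subseteq> fst j \<and> snd i \<subseteq> snd j}" for i
  have "I \<inter> \<Inter>W \<noteq> {}" if W: "finite W" "W \<subseteq> cone ` I" for W
  proof -
    \<comment> \<open>The componentwise union of the finitely many apexes is a finite subpair above
      all of them, hence in every cone of \<open>W\<close>; for empty \<open>J\<close> it is the
      empty subpair.\<close>
    obtain J where J: "J \<subseteq> I" "finite J" "W = cone ` J"
      using finite_subset_image[OF W] by blast
    then have "(\<Union>(fst ` J), \<Union>(snd ` J)) \<in> I"
      by (fastforce simp: I_def)
    then have "(\<Union>(fst ` J), \<Union>(snd ` J)) \<in> I \<inter> \<Inter>W"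
      by (auto simp: J cone_def)
    then show ?thesis
      by blast
  qed
  moreover have "cone ` I \<subseteq> Pow I"
    by (auto simp: cone_def)
  ultimately obtain U where U: "ultrafilter_on I U" and cones: "cone ` I \<subseteq> U"
    using ultrafilter_on_extends_fip[of "cone ` I" I] by blast
  define F where "F i = C2 R (fst i) (snd i)" for i
  define p where "p = ultraproduct I U F"
  have p_fst: "A \<in> fst p \<longleftrightarrow> {i \<in> I. A \<in> fst (F i)} \<in> U"
    and p_snd: "A \<in> snd p \<longleftrightarrow> {i \<in> I. A \<in> snd (F i)} \<in> U" for A
    by (simp_all add: p_def ultraproduct_def)
  have "\<forall>i\<in>I. F i \<in> theory_pairs R"
    by (auto simp: F_def theory_pairs_def)
  then have p: "p \<in> theory_pairs R"
    using closed U unfolding closed_under_ultraproducts_def p_def by simp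
  have "\<Pi> \<subseteq> fst p"
  proof
    fix A assume "A \<in> \<Pi>"
    \<comment> \<open>Every index in this cone has \<open>A\<close> in its first component, and
      extensivity of \<open>C2\<close> carries it into the factor.\<close>
    then have "cone ({A}, {}) \<in> U"
      using cones by (auto simp: I_def)
    then show "A \<in> fst p"
      unfolding p_fst
      by (rule ultrafilter_onD(2)[OF U]) (use C2_extensive(1)[OF R] in \<open>auto simp: cone_def F_def\<close>)
  qed
  moreover have "\<Sigma> \<subseteq> snd p"
  proof
    fix A assume "A \<in> \<Sigma>"
    then have "cone ({}, {A}) \<in> U"
      using cones by (auto simp: I_def)
    then show "A \<in> snd p"
      unfolding p_snd
      by (rule ultrafilter_onD(2)[OF U]) (use C2_extensive(2)[OF R] in \<open>auto simp: cone_def F_def\<close>)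
  qed
  \<comment> \<open>Every pair above \<open>p\<close> is above \<open>(\<Pi>, \<Sigma>)\<close> and
    so is related; closure of theory-pairs then forces every sentence into both components of
    \<open>p\<close>.\<close>
  ultimately have "R X Y" if "fst p \<subseteq> X" "snd p \<subseteq> Y" for X Y
    using S_consequence_weaken[OF R \<open>R \<Pi> \<Sigma>\<close>] that by (meson subset_trans)
  then have "A \<in> fst p" "A \<in> snd p" for A
    using theory_pairs_closed[OF R p] by blast+
  then have "{i \<in> I. A \<in> fst (F i)} \<in> U" "{i \<in> I. A \<in> snd (F i)} \<in> U" for A
    by (simp_all flip: p_fst p_snd)
  then have "{i \<in> I. A \<in> fst (F i)} \<inter> {i \<in> I. A \<in> snd (F i)} \<in> U" for A
    by (rule ultrafilter_onD(3)[OF U])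
  moreover have "X \<noteq> {}" if "X \<in> U" for X
    using ultrafilter_onD(1)[OF U] that by blast
  ultimately have "{i \<in> I. A \<in> fst (F i)} \<inter> {i \<in> I. A \<in> snd (F i)} \<noteq> {}" for A
    by simp
  then obtain i A where "i \<in> I" "A \<in> fst (F i)" "A \<in> snd (F i)"
    by blast
  \<comment> \<open>The two memberships of \<open>A\<close> are the premises of a cut on
    \<open>A\<close> over the generators of \<open>F i\<close>, which are the components of the
    finite subpair \<open>i\<close>.\<close>
  then have "R (fst i) (snd i)"
    using S_consequence_cut_formula[OF R] by (simp add: F_def C2_def)
  then show "\<exists>P S. finite P \<and> P \<subseteq> \<Pi> \<and> finite S \<and> S \<subseteq> \<Sigma> \<and> R P S"
    using \<open>i \<in> I\<close> by (intro exI[of _ "fst i"] exI[of _ "snd i"]) (simp add: I_def split_beta)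
qed

theorem proposition4p4:
  fixes R :: "'a set \<Rightarrow> 'a set \<Rightarrow> bool"
  assumes "S_consequence R"
  shows "(finitary R \<longleftrightarrow> closed_under_ultraproducts TYPE('a set \<times> 'a set) (theory_pairs R)) \<and>
         (finitary R \<longrightarrow> closed_under_ultraproducts TYPE('i) (theory_pairs R))"
proof (intro conjI iffI impI)
  assume "finitary R"
  then show "closed_under_ultraproducts TYPE('a set \<times> 'a set) (theory_pairs R)"
    "closed_under_ultraproducts TYPE('i) (theory_pairs R)"
    by (rule finitary_imp_closed_under_ultraproducts[OF assms])+
next
  assume "closed_under_ultraproducts TYPE('a set \<times> 'a set) (theory_pairs R)"
  then show "finitary R"
    by (rule closed_under_ultraproducts_imp_finitary[OF assms])
qed

end
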